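(* Consider an undiscounted Markov decision process of finite horizon $T$ with state space $\mathcal S$, finite action space $\mathcal A$, reward function $r\colon \mathcal S\times\mathcal A\to\mathbb R$ and deterministic transition function $F\colon\mathcal S\times\mathcal A\to\mathcal S$. Let $\pi,\tilde\pi,\mu$ be state-dependent policies. For any states $s_t, s'_l\in\mathcal S$ (at timesteps $t\in\{0,\dots,T-1\}$ and $l\in\{0,\dots,T\}$ respectively) and any action $a_t\in\mathcal A$, we have $$A^{\pi}(s_t,a_t)=A^{\pi,\mu}(s_t,s'_l;a_t),$$ and $$\Big[\sum_{a\in\mathcal A}\tilde\pi(a\mid s_t)\,Q^{\pi}(s_t,a)\Big]-V^{\pi}(s_t)=\Big[\sum_{a\in\mathcal A}\tilde\pi(a\mid s_t)\,Q^{\pi,\mu}(s_t,s'_l;a)\Big]-V^{\pi,\mu}(s_t,s'_l).$$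
   Context: A state-dependent policy $\pi$ assigns to each state $s\in\mathcal S$ a probability distribution $\pi(\cdot\mid s)$ on the finite set $\mathcal A$. Write $a s:=F(s,a)$ for the state reached from $s$ by taking action $a$. Subscripts on states and actions indicate the timestep. For a state $s_t$ at timestep $t\in\{0,\dots,T\}$, $\eta^\pi(\cdot\mid s_t)$ denotes the distribution over trajectories $\zeta_t=(s_t,a_t,s_{t+1},\dots,s_{T-1},a_{T-1},s_T)$ obtained by rolling out $\pi$ from $s_t$ at timestep $t$ up to the horizon $T$: for $j=t,\dots,T-1$, $a_j\sim\pi(\cdot\mid s_j)$ and $s_{j+1}=F(s_j,a_j)$. The accumulated return of a trajectory is $r(\zeta_t):=\sum_{j=0}^{T-1-t} r(s_{t+j},a_{t+j})$ (the empty sum, $0$, if $t=T$). Single-policy value functions (they depend on the timestep indicated by the subscript of the state; $a_ts_t$ is regarded as a state at timestep $t+1$): $$V^\pi(s_t):=\mathbb E_{\zeta_t\sim\eta^\pi(\cdot\mid s_t)}[r(\zeta_t)],\qquad Q^\pi(s_t,a_t):=r(s_t,a_t)+\mathbb E_{\zeta_{t+1}\sim\eta^\pi(\cdot\mid a_ts_t)}[r(\zeta_{t+1})],$$ $$A^\pi(s_t,a_t):=Q^\pi(s_t,a_t)-V^\pi(s_t).$$ Two-policy value functions: for policies $\pi,\mu$, a state $s_t$ at timestep $t$ and a state $s'_l$ at timestep $l$, $$V^{\pi,\mu}(s_t,s'_l):=\mathbb E_{\zeta_t\sim\eta^\pi(\cdot\mid s_t),\ \zeta'_l\sim\eta^\mu(\cdot\mid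 s'_l)}\big[r(\zeta_t)-r(\zeta'_l)\big],$$ where the expectation is over the joint distribution of $\zeta_t$ and $\zeta'_l$, the two trajectories being rolled out independently of each other (so $\zeta_t$ does not depend on $\mu$ and $\zeta'_l$ does not depend on $\pi$). Further, $$Q^{\pi,\mu}(s_t,s'_l;a_t):=r(s_t,a_t)+V^{\pi,\mu}(a_ts_t,s'_l),\qquad A^{\pi,\mu}(s_t,s'_l;a_t):=Q^{\pi,\mu}(s_t,s'_l;a_t)-V^{\pi,\mu}(s_t,s'_l).$$ *)

theory Defs
  imports "HOL-Probability.Probability_Mass_Function"
begin

type_synonym ('s, 'a) policy = "'s \<Rightarrow> 'a pmf"

text \<open>
  A trajectory \<open>(s_t, a_t, s_{t+1}, \<dots>, s_{T-1}, a_{T-1}, s_T)\<close> is represented as the pair of the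
  list \<open>[(s_t, a_t), \<dots>, (s_{T-1}, a_{T-1})]\<close> and the final state \<open>s_T\<close>.
\<close>

type_synonym ('s, 'a) trajectory = "('s \<times> 'a) list \<times> 's"

definition traj_return :: "('s \<Rightarrow> 'a \<Rightarrow> real) \<Rightarrow> ('s, 'a) trajectory \<Rightarrow> real" where
  "traj_return r \<zeta> = (\<Sum>(s, a)\<leftarrow>fst \<zeta>. r s a)"

text \<open>The natural number argument of \<open>rollout\<close> is the number of actions still to be taken.\<close>

primrec rollout ::
    "('s \<Rightarrow> 'a \<Rightarrow> 's) \<Rightarrow> ('s, 'a) policy \<Rightarrow> nat \<Rightarrow> 's \<Rightarrow> ('s, 'a) trajectory pmf" where
  "rollout F \<pi> 0 s = return_pmf ([], s)"
| "rollout F \<pi> (Suc n) s =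
    bind_pmf (\<pi> s) (\<lambda>a. map_pmf (\<lambda>(xs, s'). ((s, a) # xs, s')) (rollout F \<pi> n (F s a)))"

text \<open>
  In the definitions below, a state \<open>s\<close> at timestep \<open>t\<close> is passed as the two arguments \<open>t s\<close>;
  only timesteps \<open>t \<le> T\<close> are meaningful.
\<close>

definition traj_dist ::
    "('s \<Rightarrow> 'a \<Rightarrow> 's) \<Rightarrow> nat \<Rightarrow> ('s, 'a) policy \<Rightarrow> nat \<Rightarrow> 's \<Rightarrow> ('s, 'a) trajectory pmf" where
  "traj_dist F T \<pi> t s = rollout F \<pi> (T - t) s"

text \<open>
  With finitely many actions every trajectory distribution has finite support, so all
  expectations below are of integrable functions.
\<close>

lemma finite_set_traj_dist:
  fixes F :: "'s \<Rightarrow> 'a :: finite \<Rightarrow> 's"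
  shows "finite (set_pmf (traj_dist F T \<pi> t s))"
proof -
  have "finite (set_pmf (rollout F \<pi> n s))" for n
    by (induction n arbitrary: s) auto
  then show ?thesis
    by (simp add: traj_dist_def)
qed

definition V1 ::
    "('s \<Rightarrow> 'a \<Rightarrow> real) \<Rightarrow> ('s \<Rightarrow> 'a \<Rightarrow> 's) \<Rightarrow> nat \<Rightarrow> ('s, 'a) policy \<Rightarrow> nat \<Rightarrow> 's \<Rightarrow> real" where
  "V1 r F T \<pi> t s = measure_pmf.expectation (traj_dist F T \<pi> t s) (traj_return r)"

definition Q1 ::
    "('s \<Rightarrow> 'a \<Rightarrow> real) \<Rightarrow> ('s \<Rightarrow> 'a \<Rightarrow> 's) \<Rightarrow> nat \<Rightarrow> ('s, 'a) policy \<Rightarrow> nat \<Rightarrow> 's \<Rightarrow> 'a \<Rightarrow> real" where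
  "Q1 r F T \<pi> t s a =
    r s a + measure_pmf.expectation (traj_dist F T \<pi> (t + 1) (F s a)) (traj_return r)"

definition A1 ::
    "('s \<Rightarrow> 'a \<Rightarrow> real) \<Rightarrow> ('s \<Rightarrow> 'a \<Rightarrow> 's) \<Rightarrow> nat \<Rightarrow> ('s, 'a) policy \<Rightarrow> nat \<Rightarrow> 's \<Rightarrow> 'a \<Rightarrow> real" where
  "A1 r F T \<pi> t s a = Q1 r F T \<pi> t s a - V1 r F T \<pi> t s"

definition V2 ::
    "('s \<Rightarrow> 'a \<Rightarrow> real) \<Rightarrow> ('s \<Rightarrow> 'a \<Rightarrow> 's) \<Rightarrow> nat \<Rightarrow> ('s, 'a) policy \<Rightarrow> ('s, 'a) policy \<Rightarrow>
      nat \<Rightarrow> 's \<Rightarrow> nat \<Rightarrow> 's \<Rightarrow> real" where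
  "V2 r F T \<pi> \<mu> t s l s' =
    measure_pmf.expectation (pair_pmf (traj_dist F T \<pi> t s) (traj_dist F T \<mu> l s'))
      (\<lambda>(\<zeta>, \<zeta>'). traj_return r \<zeta> - traj_return r \<zeta>')"

definition Q2 ::
    "('s \<Rightarrow> 'a \<Rightarrow> real) \<Rightarrow> ('s \<Rightarrow> 'a \<Rightarrow> 's) \<Rightarrow> nat \<Rightarrow> ('s, 'a) policy \<Rightarrow> ('s, 'a) policy \<Rightarrow>
      nat \<Rightarrow> 's \<Rightarrow> nat \<Rightarrow> 's \<Rightarrow> 'a \<Rightarrow> real" where
  "Q2 r F T \<pi> \<mu> t s l s' a = r s a + V2 r F T \<pi> \<mu> (t + 1) (F s a) l s'"

definition A2 ::
    "('s \<Rightarrow> 'a \<Rightarrow> real) \<Rightarrow> ('s \<Rightarrow> 'a \<Rightarrow> 's) \<Rightarrow> nat \<Rightarrow> ('s, 'a) policy \<Rightarrow> ('s, 'a) policy \<Rightarrow>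
      nat \<Rightarrow> 's \<Rightarrow> nat \<Rightarrow> 's \<Rightarrow> 'a \<Rightarrow> real" where
  "A2 r F T \<pi> \<mu> t s l s' a = Q2 r F T \<pi> \<mu> t s l s' a - V2 r F T \<pi> \<mu> t s l s'"

end

theory Submission
  imports Defs
begin

text \<open>
  Only the two marginals of the joint law of the two trajectories enter a difference of returns, so
  \<open>V2\<close> is the difference of two single-policy values. The summand belonging to \<open>\<mu>\<close> does not depend
  on the action, and hence cancels in every advantage (a probability vector has total mass \<open>1\<close>).
\<close>

text \<open>Linearity applies once integrability is transferred from each marginal, \<open>p\<close>
  or \<open>q\<close>, to the product along \<open>fst\<close> or \<open>snd\<close>.\<close>

lemma expectation_pair_pmf_diff:
  fixes f :: "'x \<Rightarrow> 'z :: {banach, second_countable_topology}" and g :: "'y \<Rightarrow> 'z"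
  assumes "integrable (measure_pmf p) f" and "integrable (measure_pmf q) g"
  shows "measure_pmf.expectation (pair_pmf p q) (\<lambda>(x, y). f x - g y) =
    measure_pmf.expectation p f - measure_pmf.expectation q g"
proof -
  have f: "integrable (pair_pmf p q) (\<lambda>z. f (fst z))"
    using assms(1) integrable_map_pmf_eq[of fst "pair_pmf p q" f] by (simp add: map_fst_pair_pmf)
  have g: "integrable (pair_pmf p q) (\<lambda>z. g (snd z))"
    using assms(2) integrable_map_pmf_eq[of snd "pair_pmf p q" g] by (simp add: map_snd_pair_pmf)
  show ?thesis
    unfolding case_prod_beta' using Bochner_Integration.integral_diff[OF f g] by simp
qed

text \<open>Integrability of both returns comes from the finite support of the trajectory
  laws.\<close>

lemma V2_eq_V1_diff:
  fixes F :: "'s \<Rightarrow> 'a :: finite \<Rightarrow> 's"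
  shows "V2 r F T \<pi> \<mu> t s l s' = V1 r F T \<pi> t s - V1 r F T \<mu> l s'"
  unfolding V2_def V1_def
  by (intro expectation_pair_pmf_diff integrable_measure_pmf_finite finite_set_traj_dist)

lemma Q2_eq_Q1_diff:
  fixes F :: "'s \<Rightarrow> 'a :: finite \<Rightarrow> 's"
  shows "Q2 r F T \<pi> \<mu> t s l s' a = Q1 r F T \<pi> t s a - V1 r F T \<mu> l s'"
  unfolding Q2_def V2_eq_V1_diff by (simp add: Q1_def V1_def)

theorem lemma1:
  fixes r :: "'s \<Rightarrow> 'a :: finite \<Rightarrow> real"
    and F :: "'s \<Rightarrow> 'a \<Rightarrow> 's"
    and T t l :: nat
    and \<pi> \<pi>' \<mu> :: "('s, 'a) policy"
    and s s' :: 's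
    and a :: 'a
  assumes "t < T" and "l \<le> T"
  shows "A1 r F T \<pi> t s a = A2 r F T \<pi> \<mu> t s l s' a
    \<and> (\<Sum>b\<in>UNIV. pmf (\<pi>' s) b * Q1 r F T \<pi> t s b) - V1 r F T \<pi> t s =
      (\<Sum>b\<in>UNIV. pmf (\<pi>' s) b * Q2 r F T \<pi> \<mu> t s l s' b) - V2 r F T \<pi> \<mu> t s l s'"
proof -
  have "(\<Sum>b\<in>UNIV. pmf (\<pi>' s) b) = 1"
    by (simp add: sum_pmf_eq_1)
  \<comment> \<open>Factoring the constant \<open>V1 r F T \<mu> l s'\<close> out of the sum over
    \<open>b\<close> leaves the total mass as its coefficient.\<close>
  then have "(\<Sum>b\<in>UNIV. pmf (\<pi>' s) b * Q2 r F T \<pi> \<mu> t s l s' b) =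
      (\<Sum>b\<in>UNIV. pmf (\<pi>' s) b * Q1 r F T \<pi> t s b) - V1 r F T \<mu> l s'"
    by (simp add: Q2_eq_Q1_diff right_diff_distrib sum_subtractf flip: sum_distrib_right)
  then show ?thesis
    by (simp add: A1_def A2_def V2_eq_V1_diff Q2_eq_Q1_diff)
qed

end
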